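(* Let $\theta\in\mathbb R$ and $\nu\in\mathbb P_\varepsilon$. For all $m_1,m_2,n\in{}^*\mathbb Z^{\rm sym}_\nu(\theta)$, $$[m_1+m_2,n]_\theta=[m_1,n]_\theta+[m_2,n]_\theta.$$ If moreover $m_1,m_2$ are time-like and point in the same direction, then they satisfy the reverse triangle inequality $$[m_1+m_2]_\theta\ \ge\ [m_1]_\theta+[m_2]_\theta.$$
   Context: Fix a nonprincipal ultrafilter $\mathfrak u$ on $\mathbb N$, and let ${}^*\mathbb Z\subset{}^*\mathbb R$ be the ultrapowers of $\mathbb Z\subset\mathbb R$. Let ${}^*\mathbb R_{\rm fin}$ be the ring of bounded elements, ${}^*\mathbb R_\varepsilon$ its ideal of infinitesimals (so ${}^*\mathbb R_{\rm fin}/{}^*\mathbb R_\varepsilon\cong\mathbb R$), and $({}^*\mathbb R_{\rm fin})^\times_+$ the multiplicative group of positive elements that are neither infinite nor infinitesimal. Let $\mathbb P:=({}^*\mathbb R_{>0}\cup\{0\})/({}^*\mathbb R_{\rm fin})^\times_+$; write $\langle x\rangle\in\mathbb P$ for the class of $|x|$. $\mathbb P_\varepsilon\subset\mathbb P$ is the set of classes of positive infinitesimals. For $\theta\in\mathbb R$, ${}^*\mathbb Z(\theta)$ is the group of $n\in{}^*\mathbb Z$ for which there is a (unique) $n^\perp\in{}^*\mathbb Z$ with $\varepsilon(n):=n\theta-n^\perp\in{}^*\mathbb R_\varepsilon$; put $\nu(n):=\langle\varepsilon(n)\rangle$. The set of symmetric diophantine approximations is ${}^*\mathbb Z^{\rm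 sym}(\theta):=\{0\ne n\in{}^*\mathbb Z(\theta): |n|\cdot|\varepsilon(n)|\text{ is neither infinite nor infinitesimal}\}\cup\{0\}$, and ${}^*\mathbb Z^{\rm sym}_\nu(\theta):=\{n\in{}^*\mathbb Z^{\rm sym}(\theta):\nu(n)=\nu\}$. Define $[m,n]_\theta:=\tfrac12\big(m\,\varepsilon(n)+n\,\varepsilon(m)\big)\bmod{}^*\mathbb R_\varepsilon\in\mathbb R$ for $m,n\in{}^*\mathbb Z^{\rm sym}_\nu(\theta)$, and use the same formula when one or both arguments are sums of two elements of ${}^*\mathbb Z^{\rm sym}_\nu(\theta)$ (the expression is again finite). When $[m,m]_\theta\ge0$ put $[m]_\theta:=([m,m]_\theta)^{1/2}\geq 0$. An element $m$ is time-like if $[m,m]_\theta>0$, i.e. if the sign pair $({\rm sign}(m),{\rm sign}(\varepsilon(m)))$ is $(+,+)$ or $(-,-)$; two time-like elements point in the same direction if their sign pairs coincide. *)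

theory Defs
  imports Complex_Main
begin

definition nonprincipal_ultrafilter :: "nat filter \<Rightarrow> bool" where
  "nonprincipal_ultrafilter u \<longleftrightarrow>
     u \<noteq> bot \<and>
     (\<forall>P. eventually P u \<or> eventually (\<lambda>i. \<not> P i) u) \<and>
     (\<forall>k. \<not> eventually (\<lambda>i. i = k) u)"

definition ultra_rel :: "nat filter \<Rightarrow> ((nat \<Rightarrow> 'a) \<times> (nat \<Rightarrow> 'a)) set" where
  "ultra_rel u = {(x, y). eventually (\<lambda>i. x i = y i) u}"

definition ultrapower :: "nat filter \<Rightarrow> (nat \<Rightarrow> 'a) set set" where
  "ultrapower u = UNIV // ultra_rel u"

definition ultra_class :: "nat filter \<Rightarrow> (nat \<Rightarrow> 'a) \<Rightarrow> (nat \<Rightarrow> 'a) set" where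
  "ultra_class u x = ultra_rel u `` {x}"

text \<open>On elements of an ultrapower the union ranges over one and the same class.\<close>

definition ultra_map ::
    "nat filter \<Rightarrow> ('a \<Rightarrow> 'b) \<Rightarrow> (nat \<Rightarrow> 'a) set \<Rightarrow> (nat \<Rightarrow> 'b) set" where
  "ultra_map u f X = (\<Union>x\<in>X. ultra_class u (\<lambda>i. f (x i)))"

definition ultra_map2 ::
    "nat filter \<Rightarrow> ('a \<Rightarrow> 'b \<Rightarrow> 'c) \<Rightarrow> (nat \<Rightarrow> 'a) set \<Rightarrow> (nat \<Rightarrow> 'b) set \<Rightarrow> (nat \<Rightarrow> 'c) set" where
  "ultra_map2 u f X Y = (\<Union>x\<in>X. \<Union>y\<in>Y. ultra_class u (\<lambda>i. f (x i) (y i)))"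

definition ultra_pred2 ::
    "nat filter \<Rightarrow> ('a \<Rightarrow> 'b \<Rightarrow> bool) \<Rightarrow> (nat \<Rightarrow> 'a) set \<Rightarrow> (nat \<Rightarrow> 'b) set \<Rightarrow> bool" where
  "ultra_pred2 u R X Y \<longleftrightarrow> (\<exists>x\<in>X. \<exists>y\<in>Y. eventually (\<lambda>i. R (x i) (y i)) u)"

type_synonym hyper = "(nat \<Rightarrow> real) set"

definition hreal :: "nat filter \<Rightarrow> hyper set" where
  "hreal u = ultrapower u"

text \<open>The ultrapower of the integers, viewed inside that of the reals.\<close>

definition hint :: "nat filter \<Rightarrow> hyper set" where
  "hint u = ultra_map u real_of_int ` ultrapower u"

definition hconst :: "nat filter \<Rightarrow> real \<Rightarrow> hyper" where
  "hconst u r = ultra_class u (\<lambda>_. r)"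

definition hadd :: "nat filter \<Rightarrow> hyper \<Rightarrow> hyper \<Rightarrow> hyper" where
  "hadd u = ultra_map2 u (+)"

definition hsub :: "nat filter \<Rightarrow> hyper \<Rightarrow> hyper \<Rightarrow> hyper" where
  "hsub u = ultra_map2 u (-)"

definition hmult :: "nat filter \<Rightarrow> hyper \<Rightarrow> hyper \<Rightarrow> hyper" where
  "hmult u = ultra_map2 u (*)"

definition habs :: "nat filter \<Rightarrow> hyper \<Rightarrow> hyper" where
  "habs u = ultra_map u abs"

definition hless :: "nat filter \<Rightarrow> hyper \<Rightarrow> hyper \<Rightarrow> bool" where
  "hless u = ultra_pred2 u (<)"

definition hle :: "nat filter \<Rightarrow> hyper \<Rightarrow> hyper \<Rightarrow> bool" where
  "hle u = ultra_pred2 u (\<le>)"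

definition hsign :: "nat filter \<Rightarrow> hyper \<Rightarrow> int" where
  "hsign u x = (if hless u (hconst u 0) x then 1 else if hless u x (hconst u 0) then -1 else 0)"

definition hfin :: "nat filter \<Rightarrow> hyper set" where
  "hfin u = {x \<in> hreal u. \<exists>r>0. hle u (habs u x) (hconst u r)}"

definition hinfinitesimal :: "nat filter \<Rightarrow> hyper set" where
  "hinfinitesimal u = {x \<in> hreal u. \<forall>r>0. hless u (habs u x) (hconst u r)}"

text \<open>Reduction modulo infinitesimals, composed with the canonical isomorphism of
  finite modulo infinitesimal hyperreals with the reals; meaningful on \<^term>\<open>hfin u\<close>.\<close>

definition std_part :: "nat filter \<Rightarrow> hyper \<Rightarrow> real" where
  "std_part u x = (THE r. hsub u x (hconst u r) \<in> hinfinitesimal u)"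

definition hfin_units_pos :: "nat filter \<Rightarrow> hyper set" where
  "hfin_units_pos u = {x \<in> hfin u - hinfinitesimal u. hless u (hconst u 0) x}"

definition hnonneg :: "nat filter \<Rightarrow> hyper set" where
  "hnonneg u = {x \<in> hreal u. hless u (hconst u 0) x} \<union> {hconst u 0}"

definition growth_rel :: "nat filter \<Rightarrow> (hyper \<times> hyper) set" where
  "growth_rel u = {(x, y). x \<in> hnonneg u \<and> y \<in> hnonneg u \<and>
                           (\<exists>c\<in>hfin_units_pos u. y = hmult u c x)}"

definition growth_class :: "nat filter \<Rightarrow> hyper \<Rightarrow> hyper set" where
  "growth_class u x = growth_rel u `` {habs u x}"

definition growth :: "nat filter \<Rightarrow> hyper set set" where
  "growth u = hnonneg u // growth_rel u"

definition growth_infinitesimal :: "nat filter \<Rightarrow> hyper set set" where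
  "growth_infinitesimal u =
     {\<nu> \<in> growth u. \<exists>x\<in>hinfinitesimal u. hless u (hconst u 0) x \<and> \<nu> = growth_class u x}"

definition dioph :: "nat filter \<Rightarrow> real \<Rightarrow> hyper set" where
  "dioph u \<theta> =
     {n \<in> hint u. \<exists>k\<in>hint u. hsub u (hmult u n (hconst u \<theta>)) k \<in> hinfinitesimal u}"

definition dual :: "nat filter \<Rightarrow> real \<Rightarrow> hyper \<Rightarrow> hyper" where
  "dual u \<theta> n =
     (THE k. k \<in> hint u \<and> hsub u (hmult u n (hconst u \<theta>)) k \<in> hinfinitesimal u)"

definition err :: "nat filter \<Rightarrow> real \<Rightarrow> hyper \<Rightarrow> hyper" where
  "err u \<theta> n = hsub u (hmult u n (hconst u \<theta>)) (dual u \<theta> n)"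

definition decay :: "nat filter \<Rightarrow> real \<Rightarrow> hyper \<Rightarrow> hyper set" where
  "decay u \<theta> n = growth_class u (err u \<theta> n)"

definition dioph_sym :: "nat filter \<Rightarrow> real \<Rightarrow> hyper set" where
  "dioph_sym u \<theta> =
     {n \<in> dioph u \<theta>. n \<noteq> hconst u 0 \<and>
        hmult u (habs u n) (habs u (err u \<theta> n)) \<in> hfin u - hinfinitesimal u} \<union> {hconst u 0}"

definition dioph_sym_decay :: "nat filter \<Rightarrow> real \<Rightarrow> hyper set \<Rightarrow> hyper set" where
  "dioph_sym_decay u \<theta> \<nu> = {n \<in> dioph_sym u \<theta>. decay u \<theta> n = \<nu>}"

definition bracket :: "nat filter \<Rightarrow> real \<Rightarrow> hyper \<Rightarrow> hyper \<Rightarrow> real" where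
  "bracket u \<theta> m n =
     std_part u (hmult u (hconst u (1/2))
       (hadd u (hmult u m (err u \<theta> n)) (hmult u n (err u \<theta> m))))"

text \<open>Only meaningful where \<^term>\<open>bracket u \<theta> m m \<ge> 0\<close>.\<close>

definition bracket_norm :: "nat filter \<Rightarrow> real \<Rightarrow> hyper \<Rightarrow> real" where
  "bracket_norm u \<theta> m = sqrt (bracket u \<theta> m m)"

definition time_like :: "nat filter \<Rightarrow> real \<Rightarrow> hyper \<Rightarrow> bool" where
  "time_like u \<theta> m \<longleftrightarrow> bracket u \<theta> m m > 0"

definition sign_pair :: "nat filter \<Rightarrow> real \<Rightarrow> hyper \<Rightarrow> int \<times> int" where
  "sign_pair u \<theta> m = (hsign u m, hsign u (err u \<theta> m))"

definition same_direction :: "nat filter \<Rightarrow> real \<Rightarrow> hyper \<Rightarrow> hyper \<Rightarrow> bool" where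
  "same_direction u \<theta> m n \<longleftrightarrow> sign_pair u \<theta> m = sign_pair u \<theta> n"

end

theory Submission
  imports Defs "HOL-Analysis.Elementary_Topology"
begin

text \<open>
  Every hyperreal is represented by a real sequence, and the standard part of a finite hyperreal
  is the limit of such a sequence along the ultrafilter; bounded sequences converge by compactness.
  If \<open>m\<close>, \<open>n\<close> have the same decay \<open>\<nu>\<close>, their errors differ by a finite factor, so
  finiteness of \<open>m \<epsilon>(m)\<close> gives finiteness of \<open>m \<epsilon>(n)\<close>. Hence all limits involved exist, and
  additivity of \<open>\<epsilon>\<close> makes the bracket additive. For time-like elements pointing in the same
  direction the cross terms are positive, and the arithmetic-geometric mean inequality applied to
  \<open>m\<^sub>1 \<epsilon>(m\<^sub>2)\<close> and \<open>m\<^sub>2 \<epsilon>(m\<^sub>1)\<close> is the reverse Cauchy-Schwarz inequality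
  \<open>[m\<^sub>1, m\<^sub>2] \<ge> [m\<^sub>1] [m\<^sub>2]\<close>.
\<close>

section \<open>Computing in the ultrapower through representing sequences\<close>

lemma mem_ultra_class: "y \<in> ultra_class u x \<longleftrightarrow> eventually (\<lambda>i. x i = y i) u"
  by (simp add: ultra_class_def ultra_rel_def)

lemma ultra_class_eq_iff:
  "ultra_class u x = ultra_class u y \<longleftrightarrow> eventually (\<lambda>i. x i = y i) u"
proof
  assume "ultra_class u x = ultra_class u y"
  moreover have "y \<in> ultra_class u y" by (simp add: mem_ultra_class)
  ultimately have "y \<in> ultra_class u x" by simp
  then show "eventually (\<lambda>i. x i = y i) u" by (simp add: mem_ultra_class)
next
  assume *: "eventually (\<lambda>i. x i = y i) u"
  show "ultra_class u x = ultra_class u y"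
  proof (intro set_eqI)
    fix z
    show "z \<in> ultra_class u x \<longleftrightarrow> z \<in> ultra_class u y"
      unfolding mem_ultra_class
      by (rule eventually_cong[OF *]) simp
  qed
qed

lemma in_ultrapower_iff: "X \<in> ultrapower u \<longleftrightarrow> (\<exists>x. X = ultra_class u x)"
  by (auto simp: ultrapower_def ultra_class_def quotient_def)

text \<open>Changing the representative alters the image only off a set in the filter, so all
  classes in the defining union coincide.\<close>

lemma ultra_map_class: "ultra_map u f (ultra_class u x) = ultra_class u (\<lambda>i. f (x i))"
proof -
  have "ultra_class u (\<lambda>i. f (y i)) = ultra_class u (\<lambda>i. f (x i))" if "y \<in> ultra_class u x" for y
    using that unfolding mem_ultra_class ultra_class_eq_iff by (auto elim: eventually_mono)
  moreover have "x \<in> ultra_class u x" by (simp add: mem_ultra_class)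
  ultimately show ?thesis unfolding ultra_map_def by blast
qed

lemma ultra_map2_class:
  "ultra_map2 u f (ultra_class u x) (ultra_class u y) = ultra_class u (\<lambda>i. f (x i) (y i))"
proof -
  have "ultra_class u (\<lambda>i. f (x' i) (y' i)) = ultra_class u (\<lambda>i. f (x i) (y i))"
    if "x' \<in> ultra_class u x" "y' \<in> ultra_class u y" for x' y'
    using that unfolding mem_ultra_class ultra_class_eq_iff
    by eventually_elim simp
  moreover have "x \<in> ultra_class u x" "y \<in> ultra_class u y" by (simp_all add: mem_ultra_class)
  ultimately show ?thesis unfolding ultra_map2_def by blast
qed

lemma ultra_pred2_class:
  "ultra_pred2 u R (ultra_class u x) (ultra_class u y) \<longleftrightarrow> eventually (\<lambda>i. R (x i) (y i)) u"
proof
  assume "ultra_pred2 u R (ultra_class u x) (ultra_class u y)"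
  then obtain x' y' where "eventually (\<lambda>i. x i = x' i) u" "eventually (\<lambda>i. y i = y' i) u"
    "eventually (\<lambda>i. R (x' i) (y' i)) u"
    by (auto simp: ultra_pred2_def mem_ultra_class)
  then show "eventually (\<lambda>i. R (x i) (y i)) u"
    by eventually_elim simp
next
  assume "eventually (\<lambda>i. R (x i) (y i)) u"
  moreover have "x \<in> ultra_class u x" "y \<in> ultra_class u y" by (simp_all add: mem_ultra_class)
  ultimately show "ultra_pred2 u R (ultra_class u x) (ultra_class u y)"
    unfolding ultra_pred2_def by blast
qed

lemmas hyper_class_simps =
  hadd_def hsub_def hmult_def habs_def hless_def hle_def hconst_def
  ultra_map_class ultra_map2_class ultra_pred2_class

lemma in_hreal_iff: "X \<in> hreal u \<longleftrightarrow> (\<exists>x. X = ultra_class u x)"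
  by (simp add: hreal_def in_ultrapower_iff)

lemma ultra_class_in_hreal: "ultra_class u x \<in> hreal u"
  by (auto simp: in_hreal_iff)

lemma in_hint_iff: "X \<in> hint u \<longleftrightarrow> (\<exists>k::nat \<Rightarrow> int. X = ultra_class u (\<lambda>i. real_of_int (k i)))"
proof
  assume "X \<in> hint u"
  then obtain K where "K \<in> ultrapower u" "X = ultra_map u real_of_int K"
    by (auto simp: hint_def)
  then show "\<exists>k::nat \<Rightarrow> int. X = ultra_class u (\<lambda>i. real_of_int (k i))"
    by (auto simp: in_ultrapower_iff ultra_map_class)
next
  assume "\<exists>k::nat \<Rightarrow> int. X = ultra_class u (\<lambda>i. real_of_int (k i))"
  then obtain k :: "nat \<Rightarrow> int" where "X = ultra_map u real_of_int (ultra_class u k)"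
    by (auto simp: ultra_map_class)
  moreover have "ultra_class u k \<in> ultrapower u" by (auto simp: in_ultrapower_iff)
  ultimately show "X \<in> hint u" unfolding hint_def by blast
qed

section \<open>Finite and infinitesimal elements, standard parts as limits\<close>

lemma ultra_class_in_hfin:
  "ultra_class u x \<in> hfin u \<longleftrightarrow> (\<exists>r>0. eventually (\<lambda>i. \<bar>x i\<bar> \<le> r) u)"
  by (simp add: hfin_def ultra_class_in_hreal hyper_class_simps)

lemma ultra_class_in_hinfinitesimal: "ultra_class u x \<in> hinfinitesimal u \<longleftrightarrow> (x \<longlongrightarrow> 0) u"
  by (simp add: hinfinitesimal_def ultra_class_in_hreal hyper_class_simps tendsto_iff dist_real_def)

text \<open>Limits along a proper filter are unique, so exactly one real differs from the class of
  \<open>x\<close> by an infinitesimal.\<close>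

lemma std_part_ultra_class:
  assumes "u \<noteq> bot" "(x \<longlongrightarrow> r) u"
  shows "std_part u (ultra_class u x) = r"
proof -
  have "hsub u (ultra_class u x) (hconst u s) \<in> hinfinitesimal u \<longleftrightarrow> s = r" for s
    using tendsto_unique[OF assms(1) assms(2), of s] assms(2) LIM_zero_iff[of x s u]
    by (auto simp: hyper_class_simps ultra_class_in_hinfinitesimal)
  then show ?thesis by (simp add: std_part_def)
qed

lemma ultrafilter_bounded_tendsto:
  fixes x :: "nat \<Rightarrow> real"
  assumes "nonprincipal_ultrafilter u" "eventually (\<lambda>i. \<bar>x i\<bar> \<le> C) u"
  obtains r where "(x \<longlongrightarrow> r) u"
proof -
  have ultra: "eventually P u \<or> eventually (\<lambda>i. \<not> P i) u" and "u \<noteq> bot" for P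
    using assms(1) by (auto simp: nonprincipal_ultrafilter_def)
  have "filtermap x u \<noteq> bot"
    using \<open>u \<noteq> bot\<close> by (simp add: filtermap_bot_iff)
  moreover have "eventually (\<lambda>y. y \<in> {- C..C}) (filtermap x u)"
    using assms(2) by (auto simp: eventually_filtermap abs_le_iff elim!: eventually_mono)
  ultimately obtain r where r: "inf (nhds r) (filtermap x u) \<noteq> bot"
    using compact_Icc[of "- C" C] unfolding compact_filter by blast
  \<comment> \<open>Compactness only makes \<open>r\<close> a cluster point. The ultrafilter
    dichotomy upgrades it to a limit: if \<open>x\<close> did not stay in \<open>S\<close>, it would
    stay in the complement, which is incompatible with clustering at \<open>r\<close>.\<close>
  have "eventually (\<lambda>i. x i \<in> S) u" if S: "open S" "r \<in> S" for S
  proof (rule ccontr)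
    assume "\<not> eventually (\<lambda>i. x i \<in> S) u"
    with ultra have "eventually (\<lambda>y. y \<notin> S) (filtermap x u)"
      by (auto simp: eventually_filtermap)
    moreover have "eventually (\<lambda>y. y \<in> S) (nhds r)"
      using S by (rule eventually_nhds_in_open)
    ultimately have "eventually (\<lambda>_. False) (inf (nhds r) (filtermap x u))"
      unfolding eventually_inf by blast
    with r show False by (simp add: eventually_False)
  qed
  then show thesis using that by (auto intro: topological_tendstoI)
qed

section \<open>Approximation errors, growth classes and limits of cross products\<close>

lemma int_tendsto_zero_eventually_zero:
  fixes k :: "'a \<Rightarrow> int"
  assumes "((\<lambda>i. real_of_int (k i)) \<longlongrightarrow> 0) F"
  shows "eventually (\<lambda>i. k i = 0) F"
proof -
  have "eventually (\<lambda>i. \<bar>real_of_int (k i)\<bar> < 1) F"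
    using tendstoD[OF assms, of 1] by (simp add: dist_real_def)
  then show ?thesis by eventually_elim linarith
qed

text \<open>Discreteness of the integers makes the description in \<open>dual\<close> well defined:
  two integer sequences with infinitesimal error differ by an integer sequence tending to 0, which
  is eventually 0.\<close>

lemma err_ultra_class:
  fixes x :: "nat \<Rightarrow> real" and k :: "nat \<Rightarrow> int"
  assumes "((\<lambda>i. x i * \<theta> - k i) \<longlongrightarrow> 0) u"
  shows "err u \<theta> (ultra_class u x) = ultra_class u (\<lambda>i. x i * \<theta> - k i)"
proof -
  have "dual u \<theta> (ultra_class u x) = ultra_class u (\<lambda>i. real_of_int (k i))"
    unfolding dual_def
  proof (rule the_equality)
    show "ultra_class u (\<lambda>i. real_of_int (k i)) \<in> hint u \<and>
      hsub u (hmult u (ultra_class u x) (hconst u \<theta>)) (ultra_class u (\<lambda>i. real_of_int (k i)))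
        \<in> hinfinitesimal u"
      using assms by (auto simp: in_hint_iff hyper_class_simps ultra_class_in_hinfinitesimal)
  next
    fix K
    assume K: "K \<in> hint u \<and>
      hsub u (hmult u (ultra_class u x) (hconst u \<theta>)) K \<in> hinfinitesimal u"
    then obtain l :: "nat \<Rightarrow> int" where l: "K = ultra_class u (\<lambda>i. real_of_int (l i))"
      by (auto simp: in_hint_iff)
    with K have "((\<lambda>i. x i * \<theta> - l i) \<longlongrightarrow> 0) u"
      by (simp add: hyper_class_simps ultra_class_in_hinfinitesimal)
    from tendsto_diff[OF assms this] have "((\<lambda>i. real_of_int (l i - k i)) \<longlongrightarrow> 0) u"
      by simp
    then have "eventually (\<lambda>i. l i - k i = 0) u"
      by (rule int_tendsto_zero_eventually_zero)
    then show "K = ultra_class u (\<lambda>i. real_of_int (k i))"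
      unfolding l ultra_class_eq_iff by eventually_elim simp
  qed
  then show ?thesis by (simp add: err_def hyper_class_simps)
qed

text \<open>The class of \<open>\<bar>f\<bar>\<close> is related to itself by the unit 1. Moved
  along \<open>eq\<close>, it lies in the growth class of \<open>e\<close>, which provides a finite
  factor between \<open>\<bar>e\<bar>\<close> and \<open>\<bar>f\<bar>\<close>.\<close>

lemma growth_class_eq_imp_bound:
  assumes u: "nonprincipal_ultrafilter u"
    and eq: "growth_class u (ultra_class u e) = growth_class u (ultra_class u f)"
  obtains C where "C > 0" "eventually (\<lambda>i. \<bar>f i\<bar> \<le> C * \<bar>e i\<bar>) u"
proof -
  have ultra: "eventually P u \<or> eventually (\<lambda>i. \<not> P i) u" and "u \<noteq> bot" for P
    using u by (auto simp: nonprincipal_ultrafilter_def)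
  \<comment> \<open>The ultrafilter decides whether \<open>f\<close> vanishes, so the class of
    \<open>\<bar>f\<bar>\<close> is either zero or positive.\<close>
  have "ultra_class u (\<lambda>i. \<bar>f i\<bar>) \<in> hnonneg u"
    using ultra[of "\<lambda>i. f i = 0"]
    by (auto simp: hnonneg_def ultra_class_in_hreal hyper_class_simps ultra_class_eq_iff)
  moreover have "hconst u 1 \<in> hfin_units_pos u"
    using \<open>u \<noteq> bot\<close> unfolding hfin_units_pos_def
    by (auto simp: hyper_class_simps ultra_class_in_hfin ultra_class_in_hinfinitesimal
        tendsto_const_iff intro: exI[of _ 1])
  moreover have "hmult u (hconst u 1) (ultra_class u (\<lambda>i. \<bar>f i\<bar>)) = ultra_class u (\<lambda>i. \<bar>f i\<bar>)"
    by (simp add: hyper_class_simps)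
  ultimately have "ultra_class u (\<lambda>i. \<bar>f i\<bar>) \<in> growth_class u (ultra_class u e)"
    unfolding eq unfolding growth_class_def growth_rel_def
    by (auto simp: habs_def ultra_map_class intro!: bexI[of _ "hconst u 1"])
  then obtain c where c: "c \<in> hfin_units_pos u"
      "ultra_class u (\<lambda>i. \<bar>f i\<bar>) = hmult u c (ultra_class u (\<lambda>i. \<bar>e i\<bar>))"
    unfolding growth_class_def growth_rel_def by (auto simp: habs_def ultra_map_class)
  then obtain d where d: "c = ultra_class u d"
    by (auto simp: hfin_units_pos_def hfin_def in_hreal_iff)
  with c obtain C where C: "C > 0" "eventually (\<lambda>i. \<bar>d i\<bar> \<le> C) u"
    by (auto simp: hfin_units_pos_def ultra_class_in_hfin)
  have "eventually (\<lambda>i. \<bar>f i\<bar> = d i * \<bar>e i\<bar>) u"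
    using c(2) unfolding d by (simp add: hyper_class_simps ultra_class_eq_iff)
  with C(2) have "eventually (\<lambda>i. \<bar>f i\<bar> \<le> C * \<bar>e i\<bar>) u"
    by eventually_elim (auto intro!: mult_right_mono)
  with C(1) show thesis by (rule that)
qed

text \<open>Fixes sequences for an element and for its error together, so that later arguments deal
  with real sequences instead of classes and the description in \<open>dual\<close>.\<close>

definition represents ::
    "nat filter \<Rightarrow> real \<Rightarrow> hyper \<Rightarrow> (nat \<Rightarrow> real) \<Rightarrow> (nat \<Rightarrow> real) \<Rightarrow> bool" where
  "represents u \<theta> n x e \<longleftrightarrow> n = ultra_class u x \<and> (e \<longlongrightarrow> 0) u \<and>
     (\<exists>k::nat \<Rightarrow> int. e = (\<lambda>i. x i * \<theta> - k i))"

lemma represents_err: "represents u \<theta> n x e \<Longrightarrow> err u \<theta> n = ultra_class u e"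
  by (auto simp: represents_def err_ultra_class)

text \<open>The sum of the integer approximations approximates the sum, hence errors add. Stating
  this for \<open>represents\<close> matters because a sum may leave
  \<open>dioph_sym_decay\<close>.\<close>

lemma represents_add:
  assumes "represents u \<theta> m x e" "represents u \<theta> n y f"
  shows "represents u \<theta> (hadd u m n) (\<lambda>i. x i + y i) (\<lambda>i. e i + f i)"
proof -
  obtain k l :: "nat \<Rightarrow> int"
    where "e = (\<lambda>i. x i * \<theta> - k i)" "f = (\<lambda>i. y i * \<theta> - l i)"
    using assms by (auto simp: represents_def)
  then have "(\<lambda>i. e i + f i) = (\<lambda>i. (x i + y i) * \<theta> - (k i + l i))"
    by (auto simp: algebra_simps)
  then have "\<exists>j::nat \<Rightarrow> int. (\<lambda>i. e i + f i) = (\<lambda>i. (x i + y i) * \<theta> - j i)"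
    by (intro exI[of _ "\<lambda>i. k i + l i"]) simp
  then show ?thesis
    using assms tendsto_add_zero[of e u f] by (auto simp: represents_def hyper_class_simps)
qed

text \<open>Finiteness of the product of \<open>n\<close> with its error becomes a real bound
  \<open>C\<close> on representatives. The adjoined element 0 is treated apart, with zero sequences
  and bound 0.\<close>

lemma dioph_sym_represents:
  assumes "n \<in> dioph_sym u \<theta>"
  obtains x e C where "represents u \<theta> n x e" "eventually (\<lambda>i. \<bar>x i\<bar> * \<bar>e i\<bar> \<le> C) u"
proof (cases "n = hconst u 0")
  case True
  then have "represents u \<theta> n (\<lambda>_. 0) (\<lambda>_. 0)"
    by (auto simp: represents_def hyper_class_simps intro!: exI[of _ "\<lambda>_. 0"])
  then show thesis by (rule that[of _ _ 0]) simp
next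
  case False
  with assms have n: "n \<in> dioph u \<theta>" "hmult u (habs u n) (habs u (err u \<theta> n)) \<in> hfin u"
    by (auto simp: dioph_sym_def)
  then obtain K where "n \<in> hint u" "K \<in> hint u"
      "hsub u (hmult u n (hconst u \<theta>)) K \<in> hinfinitesimal u"
    by (auto simp: dioph_def)
  then obtain x and k :: "nat \<Rightarrow> int" where
      "n = ultra_class u x" "((\<lambda>i. x i * \<theta> - k i) \<longlongrightarrow> 0) u"
    unfolding in_hint_iff by (auto simp: hyper_class_simps ultra_class_in_hinfinitesimal)
  then have rep: "represents u \<theta> n x (\<lambda>i. x i * \<theta> - k i)"
    by (auto simp: represents_def)
  then obtain C where "eventually (\<lambda>i. \<bar>x i\<bar> * \<bar>x i * \<theta> - k i\<bar> \<le> C) u"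
    using n(2) \<open>n = _\<close> unfolding represents_err[OF rep]
    by (auto simp: hyper_class_simps ultra_class_in_hfin abs_mult)
  with rep show thesis by (rule that)
qed

text \<open>Equal decay trades \<open>f\<close> for a multiple of \<open>e\<close>, and the bound on
  \<open>x e\<close> then bounds \<open>x f\<close>. Taking \<open>n = m\<close> also yields the
  limits of the diagonal products.\<close>

lemma same_decay_cross_tendsto:
  assumes u: "nonprincipal_ultrafilter u" and "decay u \<theta> m = decay u \<theta> n"
    and m: "represents u \<theta> m x e" "eventually (\<lambda>i. \<bar>x i\<bar> * \<bar>e i\<bar> \<le> B) u"
    and n: "represents u \<theta> n y f"
  obtains r where "((\<lambda>i. x i * f i) \<longlongrightarrow> r) u"
proof -
  obtain C where C: "C > 0" "eventually (\<lambda>i. \<bar>f i\<bar> \<le> C * \<bar>e i\<bar>) u"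
    using assms(2) growth_class_eq_imp_bound[OF u, of e f]
    unfolding decay_def represents_err[OF m(1)] represents_err[OF n] by blast
  from m(2) C(2) have "eventually (\<lambda>i. \<bar>x i * f i\<bar> \<le> C * B) u"
  proof eventually_elim
    case (elim i)
    have "\<bar>x i * f i\<bar> \<le> \<bar>x i\<bar> * (C * \<bar>e i\<bar>)"
      using elim by (simp add: abs_mult mult_left_mono)
    also have "\<dots> = C * (\<bar>x i\<bar> * \<bar>e i\<bar>)" by simp
    also have "\<dots> \<le> C * B" using elim C(1) by (simp add: mult_left_mono)
    finally show ?case .
  qed
  with u show thesis by (rule ultrafilter_bounded_tendsto) (rule that)
qed

section \<open>The bracket as a limit, signs, and the mean inequality\<close>

lemma bracket_eq_limit:
  assumes "u \<noteq> bot" "represents u \<theta> m x e" "represents u \<theta> n y f"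
    and "((\<lambda>i. x i * f i) \<longlongrightarrow> r) u" "((\<lambda>i. y i * e i) \<longlongrightarrow> s) u"
  shows "bracket u \<theta> m n = (r + s) / 2"
proof -
  have "((\<lambda>i. 1 / 2 * (x i * f i + y i * e i)) \<longlongrightarrow> 1 / 2 * (r + s)) u"
    by (intro tendsto_intros assms)
  from std_part_ultra_class[OF assms(1) this] show ?thesis
    using assms(2,3) unfolding bracket_def represents_err[OF assms(2)] represents_err[OF assms(3)]
    by (simp add: represents_def hyper_class_simps)
qed

lemma hsign_eq_imp_mult_pos:
  assumes u: "nonprincipal_ultrafilter u"
    and eq: "hsign u (ultra_class u x) = hsign u (ultra_class u y)"
    and nz: "eventually (\<lambda>i. x i \<noteq> 0) u"
  shows "eventually (\<lambda>i. x i * y i > 0) u"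
proof -
  have "eventually (\<lambda>i. x i > 0) u \<or> eventually (\<lambda>i. \<not> x i > 0) u"
    using u unfolding nonprincipal_ultrafilter_def by blast
  \<comment> \<open>The second case keeps two facts: the failed positivity test resolves the nested
    \<open>if\<close> in \<open>hsign\<close>, and its almost-everywhere negation, with
    \<open>nz\<close>, makes \<open>x\<close> negative.\<close>
  then consider "eventually (\<lambda>i. x i > 0) u"
    | "\<not> eventually (\<lambda>i. x i > 0) u" "eventually (\<lambda>i. \<not> x i > 0) u" by blast
  then show ?thesis
  proof cases
    case 1
    then have "eventually (\<lambda>i. y i > 0) u"
      using eq by (auto simp: hsign_def hyper_class_simps split: if_splits)
    with 1 show ?thesis by eventually_elim simp
  next
    case 2
    from 2(2) nz have neg: "eventually (\<lambda>i. x i < 0) u" by eventually_elim simp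
    with 2(1) have "eventually (\<lambda>i. y i < 0) u"
      using eq by (auto simp: hsign_def hyper_class_simps split: if_splits)
    with neg show ?thesis by eventually_elim (simp add: mult_neg_neg)
  qed
qed

text \<open>Read \<open>a\<close>, \<open>b\<close> as an element with its error and
  \<open>c\<close>, \<open>d\<close> as a second such pair. The sign conditions make the cross
  products \<open>a * d\<close> and \<open>c * b\<close> nonnegative, and their product regroups to
  \<open>(a * b) * (c * d)\<close>.\<close>

lemma arith_geo_mean_cross:
  fixes a b c d :: real
  assumes "a * b > 0" "a * c > 0" "b * d > 0"
  shows "sqrt ((a * b) * (c * d)) \<le> (a * d + c * b) / 2"
proof -
  have "0 \<le> a * d" "0 \<le> c * b"
    using assms by (auto simp: zero_less_mult_iff zero_le_mult_iff)
  then have "sqrt ((a * d) * (c * b)) \<le> (a * d + c * b) / 2"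
    by (rule arith_geo_mean_sqrt)
  then show ?thesis by (simp add: mult_ac)
qed

theorem theorem22:
  fixes u :: "nat filter" and \<theta> :: real and \<nu> :: "hyper set"
  assumes "nonprincipal_ultrafilter u"
    and "\<nu> \<in> growth_infinitesimal u"
  shows "(\<forall>m1\<in>dioph_sym_decay u \<theta> \<nu>. \<forall>m2\<in>dioph_sym_decay u \<theta> \<nu>. \<forall>n\<in>dioph_sym_decay u \<theta> \<nu>.
            bracket u \<theta> (hadd u m1 m2) n = bracket u \<theta> m1 n + bracket u \<theta> m2 n) \<and>
         (\<forall>m1\<in>dioph_sym_decay u \<theta> \<nu>. \<forall>m2\<in>dioph_sym_decay u \<theta> \<nu>.
            time_like u \<theta> m1 \<and> time_like u \<theta> m2 \<and> same_direction u \<theta> m1 m2 \<longrightarrow>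
            bracket_norm u \<theta> (hadd u m1 m2) \<ge> bracket_norm u \<theta> m1 + bracket_norm u \<theta> m2)"
proof -
  note u = assms(1)
  have bot: "u \<noteq> bot" using u by (simp add: nonprincipal_ultrafilter_def)
  have rep: "\<exists>x e C. represents u \<theta> n x e \<and> eventually (\<lambda>i. \<bar>x i\<bar> * \<bar>e i\<bar> \<le> C) u"
    if "n \<in> dioph_sym_decay u \<theta> \<nu>" for n
    using dioph_sym_represents that unfolding dioph_sym_decay_def by blast
  have decay: "decay u \<theta> m = decay u \<theta> n"
    if "m \<in> dioph_sym_decay u \<theta> \<nu>" "n \<in> dioph_sym_decay u \<theta> \<nu>" for m n
    using that by (simp add: dioph_sym_decay_def)
  note cross = same_decay_cross_tendsto[OF u decay]

  have additive: "bracket u \<theta> (hadd u m1 m2) n = bracket u \<theta> m1 n + bracket u \<theta> m2 n"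
    if m1: "m1 \<in> dioph_sym_decay u \<theta> \<nu>" and m2: "m2 \<in> dioph_sym_decay u \<theta> \<nu>"
      and n: "n \<in> dioph_sym_decay u \<theta> \<nu>" for m1 m2 n
  proof -
    obtain x1 e1 C1 where r1: "represents u \<theta> m1 x1 e1"
        "eventually (\<lambda>i. \<bar>x1 i\<bar> * \<bar>e1 i\<bar> \<le> C1) u"
      using rep[OF m1] by blast
    obtain x2 e2 C2 where r2: "represents u \<theta> m2 x2 e2"
        "eventually (\<lambda>i. \<bar>x2 i\<bar> * \<bar>e2 i\<bar> \<le> C2) u"
      using rep[OF m2] by blast
    obtain y f C where r: "represents u \<theta> n y f" "eventually (\<lambda>i. \<bar>y i\<bar> * \<bar>f i\<bar> \<le> C) u"
      using rep[OF n] by blast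
    obtain a1 where a1: "((\<lambda>i. x1 i * f i) \<longlongrightarrow> a1) u" using cross[OF m1 n r1 r(1)] .
    obtain a2 where a2: "((\<lambda>i. x2 i * f i) \<longlongrightarrow> a2) u" using cross[OF m2 n r2 r(1)] .
    obtain b1 where b1: "((\<lambda>i. y i * e1 i) \<longlongrightarrow> b1) u" using cross[OF n m1 r r1(1)] .
    obtain b2 where b2: "((\<lambda>i. y i * e2 i) \<longlongrightarrow> b2) u" using cross[OF n m2 r r2(1)] .
    \<comment> \<open>The error of the sum is \<open>e1 + e2\<close>, so both halves of the bracket
      split into limits already known to exist.\<close>
    have "bracket u \<theta> (hadd u m1 m2) n = ((a1 + a2) + (b1 + b2)) / 2"
      using tendsto_add[OF a1 a2] tendsto_add[OF b1 b2]
      by (intro bracket_eq_limit[OF bot represents_add[OF r1(1) r2(1)] r(1)])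
        (simp_all add: algebra_simps)
    then show ?thesis
      using bracket_eq_limit[OF bot r1(1) r(1) a1 b1] bracket_eq_limit[OF bot r2(1) r(1) a2 b2]
      by (simp add: field_simps)
  qed

  have "bracket_norm u \<theta> (hadd u m1 m2) \<ge> bracket_norm u \<theta> m1 + bracket_norm u \<theta> m2"
    if m1: "m1 \<in> dioph_sym_decay u \<theta> \<nu>" and m2: "m2 \<in> dioph_sym_decay u \<theta> \<nu>"
      and tl: "time_like u \<theta> m1" "time_like u \<theta> m2" and dir: "same_direction u \<theta> m1 m2" for m1 m2
  proof -
    obtain x1 e1 C1 where r1: "represents u \<theta> m1 x1 e1"
        "eventually (\<lambda>i. \<bar>x1 i\<bar> * \<bar>e1 i\<bar> \<le> C1) u"
      using rep[OF m1] by blast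
    obtain x2 e2 C2 where r2: "represents u \<theta> m2 x2 e2"
        "eventually (\<lambda>i. \<bar>x2 i\<bar> * \<bar>e2 i\<bar> \<le> C2) u"
      using rep[OF m2] by blast
    obtain a where a: "((\<lambda>i. x1 i * e1 i) \<longlongrightarrow> a) u" using cross[OF m1 m1 r1 r1(1)] .
    obtain b where b: "((\<lambda>i. x2 i * e2 i) \<longlongrightarrow> b) u" using cross[OF m2 m2 r2 r2(1)] .
    obtain c where c: "((\<lambda>i. x1 i * e2 i) \<longlongrightarrow> c) u" using cross[OF m1 m2 r1 r2(1)] .
    obtain d where d: "((\<lambda>i. x2 i * e1 i) \<longlongrightarrow> d) u" using cross[OF m2 m1 r2 r1(1)] .
    have brackets: "bracket u \<theta> m1 m1 = a" "bracket u \<theta> m2 m2 = b"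
      using bracket_eq_limit[OF bot r1(1) r1(1) a a] bracket_eq_limit[OF bot r2(1) r2(1) b b]
      by simp_all
    have "((\<lambda>i. (x1 i + x2 i) * (e1 i + e2 i)) \<longlongrightarrow> a + c + (d + b)) u"
      using tendsto_add[OF tendsto_add[OF a c] tendsto_add[OF d b]] by (simp add: algebra_simps)
    from bracket_eq_limit[OF bot represents_add[OF r1(1) r2(1)] represents_add[OF r1(1) r2(1)] this this]
    have sum: "bracket u \<theta> (hadd u m1 m2) (hadd u m1 m2) = a + b + (c + d)" by simp
    have "a > 0" "b > 0" using tl by (simp_all add: time_like_def brackets)
    \<comment> \<open>A positive limit keeps \<open>x1\<close> and \<open>e1\<close> away from zero
      almost everywhere, as the comparison of signs requires.\<close>
    then have pos: "eventually (\<lambda>i. x1 i * e1 i > 0) u"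
      using order_tendstoD(1)[OF a] by blast
    have signs: "hsign u (ultra_class u x1) = hsign u (ultra_class u x2)"
        "hsign u (ultra_class u e1) = hsign u (ultra_class u e2)"
      using dir represents_err[OF r1(1)] represents_err[OF r2(1)] r1(1) r2(1)
      by (auto simp: same_direction_def sign_pair_def represents_def)
    have "eventually (\<lambda>i. x1 i * x2 i > 0) u"
      using pos by (intro hsign_eq_imp_mult_pos[OF u signs(1)]) (auto elim: eventually_mono)
    moreover have "eventually (\<lambda>i. e1 i * e2 i > 0) u"
      using pos by (intro hsign_eq_imp_mult_pos[OF u signs(2)]) (auto elim: eventually_mono)
    ultimately have "eventually (\<lambda>i. sqrt ((x1 i * e1 i) * (x2 i * e2 i))
        \<le> (x1 i * e2 i + x2 i * e1 i) / 2) u"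
      using pos by eventually_elim (rule arith_geo_mean_cross)
    \<comment> \<open>Passing to the limit gives reverse Cauchy-Schwarz, since
      \<open>(c + d) / 2\<close> is the bracket of \<open>m1\<close> and \<open>m2\<close>.\<close>
    then have "sqrt (a * b) \<le> (c + d) / 2"
      by (rule tendsto_le[OF bot _ _, rotated 2]) (auto intro!: tendsto_intros a b c d)
    \<comment> \<open>The square expands to \<open>a + b + 2 * sqrt (a * b)\<close>, while the
      right-hand side is the bracket of the sum with itself.\<close>
    then have "(sqrt a + sqrt b)\<^sup>2 \<le> a + b + (c + d)"
      using \<open>a > 0\<close> \<open>b > 0\<close> by (simp add: power2_sum real_sqrt_mult)
    then show ?thesis
      unfolding bracket_norm_def brackets sum by (rule real_le_rsqrt)
  qed
  with additive show ?thesis by blast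
qed

end
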